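(* Let $\widehat{\mathcal{H}}_n$ be the affine Hecke algebra with generators $T_i$ $(1\le i\le n-1)$ and $X_j^{\pm1}$ $(1\le j\le n)$. Put $\mathcal{T}_i := T_i+T_i^{-1}=2T_i-\varepsilon$, $P_j:=\frac12(X_j+X_j^{-1})$, $Q_j:=\frac12(X_j-X_j^{-1})$. Then the algebra $\widehat{\mathcal{H}}_n$ is generated by $\mathcal{T}_i$ $(1\le i\le n-1)$, $P_j$ and $Q_j$ $(1\le j\le n)$, subject to the relations $$\mathcal{T}_i^2 = q^2 +q^{-2} +2,\qquad \mathcal{T}_i \mathcal{T}_j = \mathcal{T}_j \mathcal{T}_i \quad (|i-j|>1),$$ $$\mathcal{T}_i \mathcal{T}_{i+1} \mathcal{T}_i - \mathcal{T}_{i+1} \mathcal{T}_i \mathcal{T}_{i+1} = \varepsilon^2 (\mathcal{T}_{i+1} -\mathcal{T}_i)$$ for the $\mathcal{T}_i$'s and the following additional relations: $$P_iP_j=P_jP_i,\qquad Q_iQ_j=Q_jQ_i\quad(i\ne j),$$ $$P_i^2-Q_i^2=1,\qquad P_iQ_j=Q_jP_i\quad(\text{for all } i,j),$$ $$\mathcal{T}_iP_i=P_{i+1}\mathcal{T}_i-\varepsilon(Q_{i+1}+Q_i),$$ $$\mathcal{T}_iQ_i=Q_{i+1}\mathcal{T}_i-\varepsilon(P_i+P_{i+1}).$$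
   Context: Let $q$ be a formal parameter and $\varepsilon=q-q^{-1}$. The affine Hecke algebra $\widehat{\mathcal{H}}_n$ (of type $GL$) is the $\mathbb{C}(q)$-algebra generated by $T_i$ $(1\le i\le n-1)$ and invertible elements $X_j$ $(1\le j\le n)$ (with inverses $X_j^{-1}$) subject to the relations: $(T_i-q)(T_i+q^{-1})=0$; $T_iT_{i+1}T_i=T_{i+1}T_iT_{i+1}$; $T_iT_j=T_jT_i$ for $|i-j|>1$; $X_iX_j=X_jX_i$ for all $i,j$; $T_iX_iT_i=X_{i+1}$; $T_iX_j=X_jT_i$ for $j\ne i,i+1$.
   Formalization: The relations 𝒯_iP_j = P_j𝒯_i and 𝒯_iQ_j = Q_j𝒯_i for j ≠ i, i+1 are added to the list; without them the claim fails for every n ≥ 3 (take T_i = diag(q, −1/q) for all i and X_i = ±[[0,1],[1,0]] with alternating signs). *)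

theory Defs
  imports
    Complex_Main
    "HOL-Library.Poly_Mapping"
    "HOL-Computational_Algebra.Polynomial"
    "HOL-Computational_Algebra.Fraction_Field"
    "HOL-Algebra.Module"
    "HOL-Algebra.QuotRing"
begin

section \<open>Associative unital algebras given by generators and relations\<close>

datatype 'g free_word = Word (letters: "'g list")

instantiation free_word :: (type) monoid_add
begin

definition zero_free_word :: "'a free_word" where
  "0 = Word []"

definition plus_free_word :: "'a free_word \<Rightarrow> 'a free_word \<Rightarrow> 'a free_word" where
  "v + w = Word (letters v @ letters w)"

instance
  by standard (simp_all add: zero_free_word_def plus_free_word_def)

end

text \<open>
  Noncommutative polynomials are the finitely supported coefficient functions on words. Since
  addition of words is concatenation, the convolution product of \<^theory>\<open>HOL-Library.Poly_Mapping\<close>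
  is the usual product of noncommutative polynomials.
\<close>

type_synonym ('g, 'k) ncpoly = "'g free_word \<Rightarrow>\<^sub>0 'k"

definition scalar :: "'k::field \<Rightarrow> ('g, 'k) ncpoly" where
  "scalar c = Poly_Mapping.single 0 c"

definition var :: "'g \<Rightarrow> ('g, 'k::field) ncpoly" where
  "var g = Poly_Mapping.single (Word [g]) 1"

definition free_algebra :: "'g set \<Rightarrow> ('k::field, ('g, 'k) ncpoly) module" where
  "free_algebra G =
    \<lparr>carrier = {f. \<forall>w\<in>Poly_Mapping.keys f. set (letters w) \<subseteq> G},
     mult = (*), one = 1, zero = 0, add = (+), smult = (\<lambda>c f. scalar c * f)\<rparr>"

lemma free_algebra_is_ring: "ring (free_algebra G :: ('k::field, ('g, 'k) ncpoly) module)"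
proof -
  let ?F = "free_algebra G :: ('k, ('g, 'k) ncpoly) module"
  have ops: "(\<oplus>\<^bsub>?F\<^esub>) = (+)" "(\<otimes>\<^bsub>?F\<^esub>) = (*)" "\<zero>\<^bsub>?F\<^esub> = 0" "\<one>\<^bsub>?F\<^esub> = 1"
    by (simp_all add: free_algebra_def)
  have add_closed: "f + g \<in> carrier ?F" if "f \<in> carrier ?F" "g \<in> carrier ?F" for f g
    using that Poly_Mapping.keys_add[of f g] unfolding free_algebra_def by auto
  have mult_closed: "f * g \<in> carrier ?F" if "f \<in> carrier ?F" "g \<in> carrier ?F" for f g
  proof -
    have "set (letters w) \<subseteq> G" if "w \<in> Poly_Mapping.keys (f * g)" for w
    proof -
      obtain u v where "w = u + v" "u \<in> Poly_Mapping.keys f" "v \<in> Poly_Mapping.keys g"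
        using \<open>w \<in> _\<close> Poly_Mapping.keys_mult[of f g] by blast
      then show ?thesis
        using \<open>f \<in> _\<close> \<open>g \<in> _\<close> by (simp add: free_algebra_def plus_free_word_def)
    qed
    then show ?thesis by (simp add: free_algebra_def)
  qed
  have zero_closed: "0 \<in> carrier ?F" and one_closed: "1 \<in> carrier ?F"
    by (simp_all add: free_algebra_def zero_free_word_def)
  have uminus_closed: "- f \<in> carrier ?F" if "f \<in> carrier ?F" for f
    using that by (simp add: free_algebra_def)
  show ?thesis
  proof (rule ringI)
    show "abelian_group ?F"
    proof (rule abelian_groupI)
      fix f assume "f \<in> carrier ?F"
      then show "\<exists>y\<in>carrier ?F. y \<oplus>\<^bsub>?F\<^esub> f = \<zero>\<^bsub>?F\<^esub>"
        using uminus_closed by (intro bexI[of _ "- f"]) (simp_all only: ops left_minus)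
    qed (simp_all only: ops add_closed zero_closed ac_simps add_0_left add_0_right)
    show "Group.monoid ?F"
      by (rule monoidI) (simp_all only: ops mult_closed one_closed mult.assoc mult_1_left mult_1_right)
  qed (simp_all only: ops distrib_left distrib_right)
qed

text \<open>
  Relations are pairs (left-hand side, right-hand side). In HOL-Algebra, ideals of a
  noncommutative ring are two-sided, hence so is the ideal generated by a set.
\<close>

definition relation_ideal ::
  "'g set \<Rightarrow> (('g, 'k::field) ncpoly \<times> ('g, 'k) ncpoly) set \<Rightarrow> ('g, 'k) ncpoly set" where
  "relation_ideal G R = genideal (free_algebra G) {l - r |l r. (l, r) \<in> R}"

definition residue_class ::
  "'g set \<Rightarrow> (('g, 'k::field) ncpoly \<times> ('g, 'k) ncpoly) set \<Rightarrow> ('g, 'k) ncpoly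
    \<Rightarrow> ('g, 'k) ncpoly set" where
  "residue_class G R f = relation_ideal G R +>\<^bsub>free_algebra G\<^esub> f"

definition presented_algebra ::
  "'g set \<Rightarrow> (('g, 'k::field) ncpoly \<times> ('g, 'k) ncpoly) set
    \<Rightarrow> ('k, ('g, 'k) ncpoly set) module" where
  "presented_algebra G R =
    (let A = free_algebra G Quot relation_ideal G R in
      ring.extend A
        \<lparr>smult = (\<lambda>c x. residue_class G R (scalar c) \<otimes>\<^bsub>A\<^esub> x)\<rparr>)"

definition algebra_iso :: "('k, 'a) module \<Rightarrow> ('k, 'b) module \<Rightarrow> ('a \<Rightarrow> 'b) set" where
  "algebra_iso A B =
    {h \<in> ring_iso A B. \<forall>c. \<forall>x\<in>carrier A. h (c \<odot>\<^bsub>A\<^esub> x) = c \<odot>\<^bsub>B\<^esub> h x}"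

text \<open>
  The algebra \<open>A\<close> is generated by the elements \<open>a g\<close>, for \<open>g \<in> G\<close>, subject to the relations \<open>R\<close>.
\<close>

definition is_presented_by ::
  "('k::field, 'a) module \<Rightarrow> ('g \<Rightarrow> 'a) \<Rightarrow> 'g set
    \<Rightarrow> (('g, 'k) ncpoly \<times> ('g, 'k) ncpoly) set \<Rightarrow> bool" where
  "is_presented_by A a G R \<longleftrightarrow>
    (\<exists>h \<in> algebra_iso (presented_algebra G R) A.
      \<forall>g\<in>G. h (residue_class G R (var g)) = a g)"

section \<open>The affine Hecke algebra of type GL\<close>

type_synonym Cq = "complex poly fract"

definition q :: Cq where
  "q = Fract [:0, 1:] 1"

definition eps :: Cq where
  "eps = q - inverse q"

datatype hecke_gen = T_gen nat | X_gen nat | Xinv_gen nat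

definition hecke_gens :: "nat \<Rightarrow> hecke_gen set" where
  "hecke_gens n = T_gen ` {1..<n} \<union> X_gen ` {1..n} \<union> Xinv_gen ` {1..n}"

definition hecke_relations ::
  "nat \<Rightarrow> ((hecke_gen, Cq) ncpoly \<times> (hecke_gen, Cq) ncpoly) set" where
  "hecke_relations n =
    (let T = (\<lambda>i. var (T_gen i)); X = (\<lambda>j. var (X_gen j)); Xinv = (\<lambda>j. var (Xinv_gen j)) in
      {(X j * Xinv j, 1) |j. j \<in> {1..n}} \<union>
      {(Xinv j * X j, 1) |j. j \<in> {1..n}} \<union>
      {((T i - scalar q) * (T i + scalar (inverse q)), 0) |i. i \<in> {1..<n}} \<union>
      {(T i * T (i+1) * T i, T (i+1) * T i * T (i+1)) |i. i \<in> {1..<n} \<and> i + 1 \<in> {1..<n}} \<union>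
      {(T i * T j, T j * T i) |i j. i \<in> {1..<n} \<and> j \<in> {1..<n} \<and> \<bar>int i - int j\<bar> > 1} \<union>
      {(X i * X j, X j * X i) |i j. i \<in> {1..n} \<and> j \<in> {1..n}} \<union>
      {(T i * X i * T i, X (i+1)) |i. i \<in> {1..<n}} \<union>
      {(T i * X j, X j * T i) |i j. i \<in> {1..<n} \<and> j \<in> {1..n} \<and> j \<noteq> i \<and> j \<noteq> i + 1})"

definition affine_hecke :: "nat \<Rightarrow> (Cq, (hecke_gen, Cq) ncpoly set) module" where
  "affine_hecke n = presented_algebra (hecke_gens n) (hecke_relations n)"

definition T_elt :: "nat \<Rightarrow> nat \<Rightarrow> (hecke_gen, Cq) ncpoly set" where
  "T_elt n i = residue_class (hecke_gens n) (hecke_relations n) (var (T_gen i))"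

definition X_elt :: "nat \<Rightarrow> nat \<Rightarrow> (hecke_gen, Cq) ncpoly set" where
  "X_elt n j = residue_class (hecke_gens n) (hecke_relations n) (var (X_gen j))"

definition calT_elt :: "nat \<Rightarrow> nat \<Rightarrow> (hecke_gen, Cq) ncpoly set" where
  "calT_elt n i = T_elt n i \<oplus>\<^bsub>affine_hecke n\<^esub> inv\<^bsub>affine_hecke n\<^esub> (T_elt n i)"

definition P_elt :: "nat \<Rightarrow> nat \<Rightarrow> (hecke_gen, Cq) ncpoly set" where
  "P_elt n j =
    inverse 2 \<odot>\<^bsub>affine_hecke n\<^esub>
      (X_elt n j \<oplus>\<^bsub>affine_hecke n\<^esub> inv\<^bsub>affine_hecke n\<^esub> (X_elt n j))"

definition Q_elt :: "nat \<Rightarrow> nat \<Rightarrow> (hecke_gen, Cq) ncpoly set" where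
  "Q_elt n j =
    inverse 2 \<odot>\<^bsub>affine_hecke n\<^esub>
      (X_elt n j \<ominus>\<^bsub>affine_hecke n\<^esub> inv\<^bsub>affine_hecke n\<^esub> (X_elt n j))"

section \<open>The presentation by calligraphic T, P and Q\<close>

datatype pq_gen = calT_gen nat | P_gen nat | Q_gen nat

definition pq_gens :: "nat \<Rightarrow> pq_gen set" where
  "pq_gens n = calT_gen ` {1..<n} \<union> P_gen ` {1..n} \<union> Q_gen ` {1..n}"

fun pq_elt :: "nat \<Rightarrow> pq_gen \<Rightarrow> (hecke_gen, Cq) ncpoly set" where
  "pq_elt n (calT_gen i) = calT_elt n i"
| "pq_elt n (P_gen j) = P_elt n j"
| "pq_elt n (Q_gen j) = Q_elt n j"

definition pq_relations ::
  "nat \<Rightarrow> ((pq_gen, Cq) ncpoly \<times> (pq_gen, Cq) ncpoly) set" where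
  "pq_relations n =
    (let T = (\<lambda>i. var (calT_gen i)); P = (\<lambda>j. var (P_gen j)); Q = (\<lambda>j. var (Q_gen j)) in
      {(T i ^ 2, scalar (q ^ 2 + inverse q ^ 2 + 2)) |i. i \<in> {1..<n}} \<union>
      {(T i * T j, T j * T i) |i j. i \<in> {1..<n} \<and> j \<in> {1..<n} \<and> \<bar>int i - int j\<bar> > 1} \<union>
      {(T i * T (i+1) * T i - T (i+1) * T i * T (i+1), scalar (eps ^ 2) * (T (i+1) - T i)) |i.
         i \<in> {1..<n} \<and> i + 1 \<in> {1..<n}} \<union>
      {(P i * P j, P j * P i) |i j. i \<in> {1..n} \<and> j \<in> {1..n} \<and> i \<noteq> j} \<union>
      {(Q i * Q j, Q j * Q i) |i j. i \<in> {1..n} \<and> j \<in> {1..n} \<and> i \<noteq> j} \<union>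
      {(P i ^ 2 - Q i ^ 2, 1) |i. i \<in> {1..n}} \<union>
      {(P i * Q j, Q j * P i) |i j. i \<in> {1..n} \<and> j \<in> {1..n}} \<union>
      {(T i * P i, P (i+1) * T i - scalar eps * (Q (i+1) + Q i)) |i. i \<in> {1..<n}} \<union>
      {(T i * Q i, Q (i+1) * T i - scalar eps * (P i + P (i+1))) |i. i \<in> {1..<n}})"

text \<open>
  The counterpart of \<open>T\<^sub>i X\<^sub>j = X\<^sub>j T\<^sub>i\<close> for \<open>j \<noteq> i, i + 1\<close>. It does not follow from
  \<^const>\<open>pq_relations\<close>. Counterexample for \<open>n = 3\<close>: in the two-dimensional irreducible
  representation of the finite Hecke algebra, choose an invertible matrix \<open>X\<^sub>1\<close> that does not
  commute with \<open>T\<^sub>2\<close> and satisfies \<open>tr (X\<^sub>1 T\<^sub>1) = 0\<close> and \<open>tr (X\<^sub>1\<^sup>-\<^sup>1 T\<^sub>2) = 0\<close>; with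
  \<open>X\<^sub>2 = T\<^sub>1 X\<^sub>1 T\<^sub>1\<close> and \<open>X\<^sub>3 = T\<^sub>2 X\<^sub>2 T\<^sub>2\<close>, which are multiples of \<open>X\<^sub>1\<^sup>-\<^sup>1\<close> and \<open>X\<^sub>1\<close>, the relations
  \<^const>\<open>pq_relations\<close> hold.
\<close>

definition pq_far_relations ::
  "nat \<Rightarrow> ((pq_gen, Cq) ncpoly \<times> (pq_gen, Cq) ncpoly) set" where
  "pq_far_relations n =
    (let T = (\<lambda>i. var (calT_gen i)); P = (\<lambda>j. var (P_gen j)); Q = (\<lambda>j. var (Q_gen j)) in
      {(T i * P j, P j * T i) |i j. i \<in> {1..<n} \<and> j \<in> {1..n} \<and> j \<noteq> i \<and> j \<noteq> i + 1} \<union>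
      {(T i * Q j, Q j * T i) |i j. i \<in> {1..<n} \<and> j \<in> {1..n} \<and> j \<noteq> i \<and> j \<noteq> i + 1})"

end

theory Submission
  imports Defs
begin

text \<open>
  Solving the definitions of \<open>\<T>\<^sub>i\<close>, \<open>P\<^sub>j\<close>, \<open>Q\<^sub>j\<close> for the old generators gives
  \<open>T\<^sub>i = (\<T>\<^sub>i + \<epsilon>) / 2\<close>, \<open>X\<^sub>j = P\<^sub>j + Q\<^sub>j\<close> and \<open>X\<^sub>j\<^sup>-\<^sup>1 = P\<^sub>j - Q\<^sub>j\<close>, once \<open>T\<^sub>i\<^sup>-\<^sup>1\<close> is
  written as \<open>T\<^sub>i - \<epsilon>\<close>. If \<open>T\<^sub>i\<close>, \<open>X\<^sub>j\<close> and \<open>X\<^sub>j\<^sup>-\<^sup>1\<close> are taken as independent letters, this is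
  an affine-linear change of letters, which is invertible because 2 is. It is thus an
  isomorphism of free algebras, before any relation is imposed, and the claim becomes that it
  carries one relation ideal to the other
  (\<open>presented_by_inverse_substitutions\<close>).
  
  For this it suffices that elements \<open>T, X, X\<^sup>-\<^sup>1\<close> of a presented algebra satisfy the
  Hecke relations if and only if the corresponding elements \<open>\<T>, P, Q\<close> satisfy the new
  relations (\<open>solves_hecke_iff_solves_pq\<close>). The equivalence is applied twice: to the
  generators of the Hecke algebra, which satisfy the Hecke relations by construction, and to the
  generators of the other algebra, which satisfy the new relations by construction.
  
  The equivalence holds group by group.
  \<^item> The quadratic relation for \<open>\<T>\<^sub>i\<close> and the relation between \<open>\<T>\<^sub>i\<close>
  and \<open>\<T>\<^sub>j\<close> for \<open>|i - j| > 1\<close> are four times those for the \<open>T\<close>'s.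
  \<^item> Eight times the braid relation for the \<open>T\<close>'s differs from the cubic relation for the
  \<open>\<T>\<close>'s by \<open>\<epsilon> (\<T>\<^sub>i\<^sup>2 - \<T>\<^sub>i\<^sub>+\<^sub>1\<^sup>2)\<close>, and the two squares are the same scalar.
  \<^item> That \<open>P + Q\<close> and \<open>P - Q\<close> are mutually inverse means that \<open>P\<close> and \<open>Q\<close> commute and
  \<open>P\<^sup>2 - Q\<^sup>2 = 1\<close>. What commutes with \<open>X\<close> commutes with \<open>X\<^sup>-\<^sup>1\<close>, and
  therefore with \<open>P\<close> and \<open>Q\<close>.
  \<^item> Since \<open>T\<^sub>i\<^sup>-\<^sup>1 = T\<^sub>i - \<epsilon>\<close>, the relation \<open>T\<^sub>i X\<^sub>i T\<^sub>i = X\<^sub>i\<^sub>+\<^sub>1\<close> reads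
  \<open>\<T>\<^sub>i X\<^sub>i = X\<^sub>i\<^sub>+\<^sub>1 \<T>\<^sub>i - \<epsilon> (X\<^sub>i\<^sub>+\<^sub>1 + X\<^sub>i)\<close>, and its inverse reads
  \<open>\<T>\<^sub>i X\<^sub>i\<^sup>-\<^sup>1 = X\<^sub>i\<^sub>+\<^sub>1\<^sup>-\<^sup>1 \<T>\<^sub>i + \<epsilon> (X\<^sub>i\<^sub>+\<^sub>1\<^sup>-\<^sup>1 + X\<^sub>i\<^sup>-\<^sup>1)\<close>. Half their sum and half their
  difference are the relations for \<open>\<T>\<^sub>i P\<^sub>i\<close> and \<open>\<T>\<^sub>i Q\<^sub>i\<close>.
\<close>

section \<open>Free algebras and substitution\<close>

lemma free_algebra_ops [simp]:
  "(\<oplus>\<^bsub>free_algebra G\<^esub>) = (+)" "(\<otimes>\<^bsub>free_algebra G\<^esub>) = (*)"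
  "\<zero>\<^bsub>free_algebra G\<^esub> = 0" "\<one>\<^bsub>free_algebra G\<^esub> = 1"
  by (simp_all add: free_algebra_def)

abbreviation polys :: "'g set \<Rightarrow> ('g, 'k::field) ncpoly set" where
  "polys G \<equiv> carrier (free_algebra G)"

lemma polys_iff: "f \<in> polys G \<longleftrightarrow> (\<forall>w\<in>Poly_Mapping.keys f. set (letters w) \<subseteq> G)"
  by (simp add: free_algebra_def)

lemma polys_zero [simp]: "0 \<in> polys G"
  and polys_one [simp]: "1 \<in> polys G"
  and polys_add [simp]: "f \<in> polys G \<Longrightarrow> g \<in> polys G \<Longrightarrow> f + g \<in> polys G"
  and polys_mult [simp]: "f \<in> polys G \<Longrightarrow> g \<in> polys G \<Longrightarrow> f * g \<in> polys G"
proof -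
  interpret ring "free_algebra G" by (rule free_algebra_is_ring)
  show "0 \<in> polys G" using zero_closed by simp
  show "1 \<in> polys G" using one_closed by simp
  show "f + g \<in> polys G" if "f \<in> polys G" "g \<in> polys G"
    using add.m_closed[OF that] by simp
  show "f * g \<in> polys G" if "f \<in> polys G" "g \<in> polys G"
    using m_closed[OF that] by simp
qed

lemma polys_uminus [simp]: "f \<in> polys G \<Longrightarrow> - f \<in> polys G"
  by (simp add: polys_iff)

lemma polys_diff [simp]: "f \<in> polys G \<Longrightarrow> g \<in> polys G \<Longrightarrow> f - g \<in> polys G"
  using polys_add[of f G "- g"] by simp

lemma polys_power [simp]: "f \<in> polys G \<Longrightarrow> f ^ k \<in> polys G"
  by (induction k) simp_all

lemma polys_scalar [simp]: "scalar c \<in> polys G"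
  by (auto simp: polys_iff scalar_def zero_free_word_def)

lemma polys_var [simp]: "g \<in> G \<Longrightarrow> var g \<in> polys G"
  by (auto simp: polys_iff var_def)

lemma free_algebra_a_inv [simp]: "f \<in> polys G \<Longrightarrow> \<ominus>\<^bsub>free_algebra G\<^esub> f = - f"
proof -
  assume "f \<in> polys G"
  interpret ring "free_algebra G" by (rule free_algebra_is_ring)
  show ?thesis
    by (rule minus_equality) (use \<open>f \<in> polys G\<close> in simp_all)
qed

lemma free_algebra_a_minus [simp]:
  "f \<in> polys G \<Longrightarrow> g \<in> polys G \<Longrightarrow> f \<ominus>\<^bsub>free_algebra G\<^esub> g = f - g"
  by (simp add: a_minus_def)

lemma scalar_simps:
  "scalar 0 = 0" "scalar 1 = 1" "scalar (c + d) = scalar c + scalar d"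
  "scalar (c * d) = scalar c * scalar d"
  by (simp_all add: scalar_def single_add mult_single)

lemma scalar_diff: "scalar (c - d) = scalar c - scalar d"
  by (simp add: scalar_def single_diff)

lemma single_word: "Poly_Mapping.single (Word w) c = scalar c * prod_list (map var w)"
proof (induction w arbitrary: c)
  case Nil
  then show ?case by (simp add: scalar_def zero_free_word_def)
next
  case (Cons g w)
  have "Poly_Mapping.single (Word (g # w)) c
      = Poly_Mapping.single (Word [g]) c * Poly_Mapping.single (Word w) 1"
    by (simp add: mult_single plus_free_word_def)
  also have "Poly_Mapping.single (Word [g]) c = scalar c * var g"
    by (simp add: scalar_def var_def mult_single)
  finally show ?case
    by (simp add: Cons.IH scalar_simps mult.assoc)
qed

lemma polys_induct_monomial [consumes 1, case_names single add]:
  assumes f: "f \<in> polys G"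
    and single: "\<And>w c. set (letters w) \<subseteq> G \<Longrightarrow> P (Poly_Mapping.single w c)"
    and add: "\<And>f g. f \<in> polys G \<Longrightarrow> g \<in> polys G \<Longrightarrow> P f \<Longrightarrow> P g \<Longrightarrow> P (f + g)"
  shows "P f"
proof -
  have "P (\<Sum>w\<in>A. Poly_Mapping.single w (Poly_Mapping.lookup f w))
      \<and> (\<Sum>w\<in>A. Poly_Mapping.single w (Poly_Mapping.lookup f w)) \<in> polys G"
    if "finite A" "A \<subseteq> Poly_Mapping.keys f" for A
    using that
  proof (induction A rule: finite_induct)
    case empty
    then show ?case using single[of 0 0] by (simp add: zero_free_word_def)
  next
    case (insert w A)
    then have "set (letters w) \<subseteq> G"
      using f by (auto simp: polys_iff)
    then have "Poly_Mapping.single w (Poly_Mapping.lookup f w) \<in> polys G"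
      by (simp add: polys_iff)
    then show ?case
      using insert single[OF \<open>set (letters w) \<subseteq> G\<close>] by (auto intro: add)
  qed
  moreover have "f = (\<Sum>w\<in>Poly_Mapping.keys f. Poly_Mapping.single w (Poly_Mapping.lookup f w))"
    by (rule poly_mapping_eqI)
      (simp add: lookup_sum lookup_single when_def sum.delta in_keys_iff)
  ultimately show ?thesis
    by (metis finite_keys order_refl)
qed

text \<open>
  The free algebra is generated by its letters over the scalars; this is how identities between
  algebra homomorphisms are checked on generators below.
\<close>

lemma polys_induct [consumes 1, case_names scalar var add mult]:
  assumes f: "f \<in> polys G"
    and scalar: "\<And>c. P (scalar c)"
    and var: "\<And>g. g \<in> G \<Longrightarrow> P (var g)"
    and add: "\<And>f g. f \<in> polys G \<Longrightarrow> g \<in> polys G \<Longrightarrow> P f \<Longrightarrow> P g \<Longrightarrow> P (f + g)"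
    and mult: "\<And>f g. f \<in> polys G \<Longrightarrow> g \<in> polys G \<Longrightarrow> P f \<Longrightarrow> P g \<Longrightarrow> P (f * g)"
  shows "P f"
  using f
proof (induction f rule: polys_induct_monomial)
  case (single w c)
  have "prod_list (map var v) \<in> {f \<in> polys G. P f}" if "set v \<subseteq> G" for v
    using that scalar[of 1] by (induction v) (auto simp: scalar_simps intro!: mult var)
  from this[OF single] show ?case
    using single_word[of "letters w" c] by (auto intro: mult scalar)
qed (rule add)

lemma polys_UNIV: "f \<in> polys UNIV"
  by (simp add: polys_iff)

lemma scalar_commute: "f * scalar c = scalar c * f"
  using polys_UNIV[of f]
proof (induction f rule: polys_induct)
  case (mult f g)
  then show ?case by (metis mult.assoc)
qed (simp_all add: scalar_def var_def mult_single distrib_left distrib_right mult.commute)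

lemma scalar_left_commute: "f * (scalar c * g) = scalar c * (f * g)"
  by (metis scalar_commute mult.assoc)

definition subst :: "('g \<Rightarrow> ('h, 'k) ncpoly) \<Rightarrow> ('g, 'k::field) ncpoly \<Rightarrow> ('h, 'k) ncpoly" where
  "subst a f = (\<Sum>w\<in>Poly_Mapping.keys f.
     scalar (Poly_Mapping.lookup f w) * prod_list (map a (letters w)))"

lemma subst_single: "subst a (Poly_Mapping.single w c) = scalar c * prod_list (map a (letters w))"
  by (cases "c = 0") (simp_all add: subst_def scalar_simps)

lemma subst_superset:
  assumes "finite A" "Poly_Mapping.keys f \<subseteq> A"
  shows "subst a f = (\<Sum>w\<in>A. scalar (Poly_Mapping.lookup f w) * prod_list (map a (letters w)))"
  unfolding subst_def using assms
  by (intro sum.mono_neutral_left) (auto simp: scalar_simps in_keys_iff)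

lemma subst_add [simp]: "subst a (f + g) = subst a f + subst a g"
  using Poly_Mapping.keys_add[of f g]
  by (simp add: subst_superset[of "Poly_Mapping.keys f \<union> Poly_Mapping.keys g"]
      lookup_add scalar_simps distrib_right sum.distrib)

lemma subst_scalar [simp]: "subst a (scalar c) = scalar c"
  by (simp add: scalar_def[of c] subst_single zero_free_word_def)

lemma subst_var [simp]: "subst a (var g) = a g"
  by (simp add: var_def subst_single scalar_simps)

lemma subst_zero [simp]: "subst a 0 = 0"
  by (simp add: subst_def)

lemma subst_one [simp]: "subst a 1 = 1"
  using subst_scalar[of a 1] by (simp add: scalar_simps)

lemma subst_uminus [simp]: "subst a (- f) = - subst a f"
  using subst_add[of a f "- f"] by (simp add: add_eq_0_iff2 minus_equation_iff)

lemma subst_diff [simp]: "subst a (f - g) = subst a f - subst a g"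
  using subst_add[of a f "- g"] by simp

lemma subst_mult [simp]: "subst a (f * g) = subst a f * subst a g"
  using polys_UNIV[of f]
proof (induction f rule: polys_induct_monomial)
  case (single v c)
  show ?case
    using polys_UNIV[of g]
  proof (induction g rule: polys_induct_monomial)
    case (single w d)
    show ?case
      by (simp add: mult_single subst_single plus_free_word_def scalar_simps mult.assoc
          scalar_left_commute[of "prod_list (map a (letters v))"])
  qed (simp add: distrib_left)
qed (simp add: distrib_right)

lemma subst_power [simp]: "subst a (f ^ k) = subst a f ^ k"
  by (induction k) simp_all

lemma subst_polys:
  assumes "f \<in> polys G" "a ` G \<subseteq> polys H"
  shows "subst a f \<in> polys H"
  using assms(1) by (induction f rule: polys_induct) (use assms(2) in auto)

lemma subst_var_id [simp]: "subst var f = f"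
  using polys_UNIV[of f] by (induction f rule: polys_induct) simp_all

section \<open>Congruence modulo the relation ideal\<close>

text \<open>
  The quotient by the relation ideal is a ring of cosets, in which term rewriting is awkward.
  Computations are therefore done with representatives in the free algebra, whose type is a
  \<^class>\<open>ring_1\<close>, and transferred by the lemmas on residues below.
\<close>

lemma (in ideal) rcos_class_ops:
  assumes "x \<in> carrier R" "y \<in> carrier R"
  shows "(I +> x) \<oplus>\<^bsub>R Quot I\<^esub> (I +> y) = I +> (x \<oplus> y)"
    and "(I +> x) \<otimes>\<^bsub>R Quot I\<^esub> (I +> y) = I +> (x \<otimes> y)"
  using ring_hom_add[OF rcos_ring_hom assms] ring_hom_mult[OF rcos_ring_hom assms] by simp_all

lemma presented_algebra_ops:
  "carrier (presented_algebra G R) = carrier (free_algebra G Quot relation_ideal G R)"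
  "(\<oplus>\<^bsub>presented_algebra G R\<^esub>) = (\<oplus>\<^bsub>free_algebra G Quot relation_ideal G R\<^esub>)"
  "(\<otimes>\<^bsub>presented_algebra G R\<^esub>) = (\<otimes>\<^bsub>free_algebra G Quot relation_ideal G R\<^esub>)"
  "\<zero>\<^bsub>presented_algebra G R\<^esub> = \<zero>\<^bsub>free_algebra G Quot relation_ideal G R\<^esub>"
  "\<one>\<^bsub>presented_algebra G R\<^esub> = \<one>\<^bsub>free_algebra G Quot relation_ideal G R\<^esub>"
  "c \<odot>\<^bsub>presented_algebra G R\<^esub> x
    = residue_class G R (scalar c) \<otimes>\<^bsub>free_algebra G Quot relation_ideal G R\<^esub> x"
  by (simp_all add: presented_algebra_def Let_def ring.defs)

locale presentation =
  fixes G :: "'g set" and R :: "(('g, 'k::field) ncpoly \<times> ('g, 'k) ncpoly) set"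
  assumes relations_polys: "(l, r) \<in> R \<Longrightarrow> l \<in> polys G" "(l, r) \<in> R \<Longrightarrow> r \<in> polys G"
begin

sublocale free: ring "free_algebra G :: ('k, ('g, 'k) ncpoly) module"
  by (rule free_algebra_is_ring)

sublocale relations: ideal "relation_ideal G R" "free_algebra G"
  unfolding relation_ideal_def
  by (rule free.genideal_ideal) (auto intro!: polys_diff intro: relations_polys)

abbreviation "alg \<equiv> presented_algebra G R"

abbreviation "residue \<equiv> residue_class G R"

definition cong :: "('g, 'k) ncpoly \<Rightarrow> ('g, 'k) ncpoly \<Rightarrow> bool" (infix "\<approx>" 50) where
  "f \<approx> g \<longleftrightarrow> f \<in> polys G \<and> g \<in> polys G \<and> f - g \<in> relation_ideal G R"

lemma ideal_polys: "f \<in> relation_ideal G R \<Longrightarrow> f \<in> polys G"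
  by (rule relations.Icarr)

lemma ideal_closed:
  "0 \<in> relation_ideal G R"
  "f \<in> relation_ideal G R \<Longrightarrow> g \<in> relation_ideal G R \<Longrightarrow> f + g \<in> relation_ideal G R"
  "f \<in> relation_ideal G R \<Longrightarrow> - f \<in> relation_ideal G R"
  "f \<in> relation_ideal G R \<Longrightarrow> g \<in> relation_ideal G R \<Longrightarrow> f - g \<in> relation_ideal G R"
  "u \<in> polys G \<Longrightarrow> f \<in> relation_ideal G R \<Longrightarrow> u * f \<in> relation_ideal G R"
  "f \<in> relation_ideal G R \<Longrightarrow> u \<in> polys G \<Longrightarrow> f * u \<in> relation_ideal G R"
  using relations.zero_closed relations.a_closed[of f g] relations.a_inv_closed[of f]
    relations.a_closed[of f "- g"] relations.a_inv_closed[of g]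
    relations.I_l_closed[of f u] relations.I_r_closed[of f u]
  by (auto simp: ideal_polys)

lemma relation_cong: "(l, r) \<in> R \<Longrightarrow> l \<approx> r"
proof -
  assume "(l, r) \<in> R"
  moreover have "{l - r |l r. (l, r) \<in> R} \<subseteq> relation_ideal G R"
    unfolding relation_ideal_def
    by (rule free.genideal_self) (auto intro!: polys_diff intro: relations_polys)
  ultimately show "l \<approx> r"
    by (auto simp: cong_def intro: relations_polys)
qed

lemma cong_refl: "f \<in> polys G \<Longrightarrow> f \<approx> f"
  by (simp add: cong_def ideal_closed)

lemma cong_sym: "f \<approx> g \<Longrightarrow> g \<approx> f"
  using ideal_closed(3)[of "f - g"] by (simp add: cong_def)

lemma residue_eq_iff:
  assumes "f \<in> polys G" "g \<in> polys G"
  shows "residue f = residue g \<longleftrightarrow> f \<approx> g"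
  using free.quotient_eq_iff_same_a_r_cos[OF relations.is_ideal, of f g] assms
  by (simp add: residue_class_def cong_def)

lemma carrier_algebra: "carrier alg = residue ` polys G"
  by (auto simp: presented_algebra_ops FactRing_def A_RCOSETS_def' residue_class_def)

lemma residue_closed [simp]: "f \<in> polys G \<Longrightarrow> residue f \<in> carrier alg"
  by (simp add: carrier_algebra)

lemma residue_one: "\<one>\<^bsub>alg\<^esub> = residue 1"
  and residue_add:
    "f \<in> polys G \<Longrightarrow> g \<in> polys G \<Longrightarrow> residue f \<oplus>\<^bsub>alg\<^esub> residue g = residue (f + g)"
  and residue_mult:
    "f \<in> polys G \<Longrightarrow> g \<in> polys G \<Longrightarrow> residue f \<otimes>\<^bsub>alg\<^esub> residue g = residue (f * g)"
  and residue_smult: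
    "f \<in> polys G \<Longrightarrow> c \<odot>\<^bsub>alg\<^esub> residue f = residue (scalar c * f)"
  using relations.rcos_class_ops[of f g] relations.rcos_class_ops[of "scalar c" f]
  by (simp_all add: presented_algebra_ops residue_class_def FactRing_def)

lemma residue_zero: "\<zero>\<^bsub>alg\<^esub> = residue 0"
  using free.a_coset_add_zero[OF relations.a_subset]
  by (simp add: presented_algebra_ops FactRing_def residue_class_def)

lemma algebra_is_ring: "ring alg"
proof (rule ringI)
  show "abelian_group alg"
  proof (rule abelian_groupI)
    fix x assume "x \<in> carrier alg"
    then obtain f where "f \<in> polys G" "x = residue f"
      by (auto simp: carrier_algebra)
    then show "\<exists>y\<in>carrier alg. y \<oplus>\<^bsub>alg\<^esub> x = \<zero>\<^bsub>alg\<^esub>"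
      by (intro bexI[of _ "residue (- f)"]) (simp_all add: residue_add residue_zero)
  qed (auto simp: carrier_algebra residue_add residue_zero add_ac)
  show "Group.monoid alg"
    by (rule monoidI) (auto simp: carrier_algebra residue_mult residue_one mult.assoc)
qed (auto simp: carrier_algebra residue_add residue_mult algebra_simps)

sublocale alg: ring alg
  by (rule algebra_is_ring)

lemma residue_diff:
  assumes "f \<in> polys G" "g \<in> polys G"
  shows "residue f \<ominus>\<^bsub>alg\<^esub> residue g = residue (f - g)"
proof -
  have "residue (f - g) \<oplus>\<^bsub>alg\<^esub> residue g = residue f"
    using assms by (simp add: residue_add)
  then show ?thesis
    using assms by (metis alg.add.inv_solve_right' residue_closed polys_diff a_minus_def)
qed

lemma residue_inverse:
  assumes "f * g \<approx> 1" "g * f \<approx> 1" "f \<in> polys G" "g \<in> polys G"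
  shows "residue f \<in> Units alg" "inv\<^bsub>alg\<^esub> residue f = residue g"
proof -
  have inverse: "residue f \<otimes>\<^bsub>alg\<^esub> residue g = \<one>\<^bsub>alg\<^esub>"
      "residue g \<otimes>\<^bsub>alg\<^esub> residue f = \<one>\<^bsub>alg\<^esub>"
    using assms by (simp_all add: residue_mult residue_one residue_eq_iff)
  show "residue f \<in> Units alg"
    unfolding Units_def using assms inverse by (auto intro!: bexI[of _ "residue g"])
  show "inv\<^bsub>alg\<^esub> residue f = residue g"
    using assms inverse by (simp add: alg.inv_char)
qed

end

lemma subst_subst: "subst b (subst a f) = subst (\<lambda>g. subst b (a g)) f"
  using polys_UNIV[of f] by (induction f rule: polys_induct) simp_all

lemma subst_eq_id:
  assumes "f \<in> polys G" "\<And>g. g \<in> G \<Longrightarrow> a g = var g"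
  shows "subst a f = f"
  using assms(1) by (induction f rule: polys_induct) (simp_all add: assms(2))

text \<open>
  The elements \<open>a h\<close> satisfy the relations \<open>S\<close> in the algebra presented by \<open>G\<close> and \<open>R\<close>.
\<close>

definition solves ::
  "'g set \<Rightarrow> (('g, 'k::field) ncpoly \<times> ('g, 'k) ncpoly) set \<Rightarrow> ('h \<Rightarrow> ('g, 'k) ncpoly)
    \<Rightarrow> (('h, 'k) ncpoly \<times> ('h, 'k) ncpoly) set \<Rightarrow> bool" where
  "solves G R a S \<longleftrightarrow> (\<forall>(l, r)\<in>S. presentation.cong G R (subst a l) (subst a r))"

lemma (in presentation) var_solves: "solves G R var R"
  by (auto simp: solves_def intro: relation_cong)

lemma subst_ring_hom:
  assumes "a ` G \<subseteq> polys H"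
  shows "ring_hom_ring (free_algebra G) (free_algebra H) (subst a)"
  by (intro ring_hom_ringI2 ring_hom_memI free_algebra_is_ring)
    (simp_all add: subst_polys[OF _ assms])

text \<open>
  By von Dyck's principle a solution of the relations \<open>R\<close> induces a map of quotients: the
  preimage of a two-sided ideal is a two-sided ideal, and here it contains the generators of the
  relation ideal of \<open>R\<close>.
\<close>

lemma subst_relation_ideal:
  assumes "presentation H S" "a ` G \<subseteq> polys H" "solves H S a R"
    and "presentation G R" "f \<in> relation_ideal G R"
  shows "subst a f \<in> relation_ideal H S"
proof -
  interpret G: presentation G R by fact
  interpret H: presentation H S by fact
  interpret hom: ring_hom_ring "free_algebra G" "free_algebra H" "subst a"
    by (rule subst_ring_hom) fact
  have "relation_ideal G R \<subseteq> {f \<in> polys G. subst a f \<in> relation_ideal H S}"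
    unfolding relation_ideal_def[of G R]
  proof (rule G.free.genideal_minimal)
    show "ideal {f \<in> polys G. subst a f \<in> relation_ideal H S} (free_algebra G)"
      by (rule hom.ideal_vimage) (rule H.relations.is_ideal)
    show "{l - r |l r. (l, r) \<in> R} \<subseteq> {f \<in> polys G. subst a f \<in> relation_ideal H S}"
      using \<open>solves H S a R\<close> by (auto simp: solves_def H.cong_def G.relations_polys)
  qed
  then show ?thesis using assms(5) by auto
qed

text \<open>
  The composite of \<^term>\<open>subst a\<close> with the quotient map is surjective because
  \<^term>\<open>subst b\<close> is a section, and its kernel is the relation ideal of \<open>R\<close>: one inclusion is the
  previous lemma for \<open>a\<close>, the other is the same lemma for \<open>b\<close>. The isomorphism is then the one
  of the first isomorphism theorem.
\<close>

theorem presented_by_inverse_substitutions: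
  fixes a :: "'g \<Rightarrow> ('h, 'k::field) ncpoly" and b :: "'h \<Rightarrow> ('g, 'k) ncpoly"
  assumes pres_R: "presentation G R" and pres_S: "presentation H S"
    and a_polys: "a ` G \<subseteq> polys H" and b_polys: "b ` H \<subseteq> polys G"
    and a_solves: "solves H S a R" and b_solves: "solves G R b S"
    and ab: "\<And>h. h \<in> H \<Longrightarrow> subst a (b h) = var h"
    and ba: "\<And>g. g \<in> G \<Longrightarrow> subst b (a g) = var g"
  shows "is_presented_by (presented_algebra H S) (\<lambda>g. residue_class H S (a g)) G R"
proof -
  interpret R: presentation G R by (rule pres_R)
  interpret S: presentation H S by (rule pres_S)
  let ?h = "\<lambda>f. S.residue (subst a f)"
  have a_inv: "subst a (subst b f) = f" if "f \<in> polys H" for f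
    unfolding subst_subst using ab by (rule subst_eq_id[OF that])
  have b_inv: "subst b (subst a f) = f" if "f \<in> polys G" for f
    unfolding subst_subst using ba by (rule subst_eq_id[OF that])
  have a_closed: "subst a f \<in> polys H" if "f \<in> polys G" for f
    using that a_polys by (rule subst_polys)
  have b_closed: "subst b f \<in> polys G" if "f \<in> polys H" for f
    using that b_polys by (rule subst_polys)
  interpret hom: ring_hom_ring "free_algebra G" "S.alg" ?h
    by (intro ring_hom_ringI2 ring_hom_memI free_algebra_is_ring S.algebra_is_ring)
      (simp_all add: a_closed S.residue_add S.residue_mult S.residue_one)
  have surj: "?h ` polys G = carrier S.alg"
  proof -
    have "subst a ` polys G = polys H"
    proof
      show "subst a ` polys G \<subseteq> polys H" using a_closed by blast
      show "polys H \<subseteq> subst a ` polys G"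
      proof
        fix f :: "('h, 'k) ncpoly" assume "f \<in> polys H"
        then show "f \<in> subst a ` polys G"
          by (intro image_eqI[of f "subst a" "subst b f"]) (simp_all only: a_inv b_closed)
      qed
    qed
    then show ?thesis
      unfolding S.carrier_algebra by (metis image_image)
  qed
  have zero: "?h f = \<zero>\<^bsub>S.alg\<^esub> \<longleftrightarrow> subst a f \<in> relation_ideal H S" if "f \<in> polys G" for f
    using S.residue_eq_iff[OF a_closed[OF that] polys_zero] a_closed[OF that]
    by (simp add: S.cong_def S.residue_zero)
  have kernel: "a_kernel (free_algebra G) S.alg ?h = relation_ideal G R"
  proof
    show "a_kernel (free_algebra G) S.alg ?h \<subseteq> relation_ideal G R"
    proof
      fix f assume "f \<in> a_kernel (free_algebra G) S.alg ?h"
      then have f: "f \<in> polys G" "subst a f \<in> relation_ideal H S"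
        unfolding a_kernel_def' using zero[of f] by blast+
      show "f \<in> relation_ideal G R"
        using subst_relation_ideal[OF pres_R b_polys b_solves pres_S f(2)] b_inv[OF f(1)] by simp
    qed
    show "relation_ideal G R \<subseteq> a_kernel (free_algebra G) S.alg ?h"
    proof
      fix f assume f: "f \<in> relation_ideal G R"
      then have "?h f = \<zero>\<^bsub>S.alg\<^esub>"
        using subst_relation_ideal[OF pres_S a_polys a_solves pres_R f]
        by (simp only: zero R.ideal_polys)
      then show "f \<in> a_kernel (free_algebra G) S.alg ?h"
        using R.ideal_polys[OF f] by (simp only: a_kernel_def' mem_Collect_eq simp_thms)
    qed
  qed
  let ?k = "\<lambda>C. the_elem (?h ` C)"
  have k_residue: "?k (R.residue f) = ?h f" if "f \<in> polys G" for f
    using hom.the_elem_simp[OF that] unfolding kernel residue_class_def[of G] by simp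
  have iso: "?k \<in> ring_iso R.alg S.alg"
    using hom.FactRing_iso_set[OF surj]
    unfolding kernel ring_iso_def ring_hom_def presented_algebra_ops(1-5)[of G R] .
  have linear: "?k (c \<odot>\<^bsub>R.alg\<^esub> x) = c \<odot>\<^bsub>S.alg\<^esub> ?k x" if carr: "x \<in> carrier R.alg" for c x
  proof -
    obtain f where f: "f \<in> polys G" and x: "x = R.residue f"
      using carr unfolding R.carrier_algebra by blast
    have "?k (c \<odot>\<^bsub>R.alg\<^esub> x) = ?h (scalar c * f)"
      unfolding x R.residue_smult[OF f] by (rule k_residue[OF polys_mult[OF polys_scalar f]])
    also have "\<dots> = c \<odot>\<^bsub>S.alg\<^esub> ?h f"
      unfolding S.residue_smult[OF a_closed[OF f]] subst_mult subst_scalar by (rule refl)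
    also have "?h f = ?k x"
      unfolding x by (rule k_residue[OF f, symmetric])
    finally show ?thesis .
  qed
  have generators: "?k (R.residue (var g)) = S.residue (a g)" if "g \<in> G" for g
    using k_residue[OF polys_var[OF that]] by (simp only: subst_var)
  have "?k \<in> algebra_iso R.alg S.alg"
    unfolding algebra_iso_def by (intro CollectI conjI allI ballI iso linear)
  then show ?thesis
    unfolding is_presented_by_def by (rule bexI[rotated]) (intro ballI generators)
qed

section \<open>Scalars of the Hecke algebra\<close>

text \<open>
  These rules loop on products of scalars, so they are only used instantiated at a factor that
  is not a scalar.
\<close>

lemmas scalar_central = scalar_commute scalar_left_commute

lemma two_neq_zero: "(2 :: Cq) \<noteq> 0"
proof -
  have "(2 :: Cq) = 1 + 1" by simp
  also have "\<dots> = Fract 2 1" unfolding One_fract_def by simp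
  also have "\<dots> \<noteq> 0" by (simp add: Zero_fract_def eq_fract)
  finally show ?thesis .
qed

lemma half_double: "scalar (inverse 2 :: Cq) * (f + f) = f"
proof -
  have "scalar (inverse 2 :: Cq) * (f + f) = scalar (inverse 2 + inverse 2) * f"
    by (simp only: scalar_simps distrib_left distrib_right)
  also have "inverse 2 + inverse 2 = (1 :: Cq)"
    using two_neq_zero by (simp flip: mult_2)
  finally show ?thesis
    by (simp add: scalar_simps)
qed

lemma q_neq_zero: "q \<noteq> 0"
  by (simp add: q_def Zero_fract_def eq_fract)

lemma quadratic_factors:
  fixes T :: "('g, Cq) ncpoly"
  shows "(T - scalar q) * (T + scalar (inverse q)) = T * T - scalar eps * T - 1"
proof -
  have "scalar (q * inverse q) = (1 :: ('g, Cq) ncpoly)"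
    using q_neq_zero by (simp add: scalar_simps(2))
  then show ?thesis
    by (simp add: eps_def scalar_diff scalar_simps(4) algebra_simps scalar_commute[of T])
qed

text \<open>
  With \<open>\<T> = 2T - \<epsilon>\<close> this constant equals \<open>\<epsilon>\<^sup>2 + 4\<close>; in this form
  \<open>\<T>\<^sup>2\<close> minus it is visibly \<open>4 (T\<^sup>2 - \<epsilon> T - 1)\<close>. The 4 is spelled as a sum of
  ones, since the identities below are checked by expanding into sums of products
  without numerical coefficients.
\<close>

lemma scalar_eps_square:
  "scalar (q\<^sup>2 + (inverse q)\<^sup>2 + 2) = scalar eps * scalar eps + (1 + 1 + (1 + 1))"
proof -
  have "q\<^sup>2 + (inverse q)\<^sup>2 + 2 = eps * eps + (1 + 1 + (1 + 1))"
    using q_neq_zero by (simp add: eps_def power2_eq_square algebra_simps)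
  then show ?thesis
    by (simp only: scalar_simps)
qed

section \<open>Comparing relations\<close>

text \<open>
  The lemmas of this part concern arbitrary elements of a presented algebra, so that each of them
  serves for both presentations. Fractions are avoided by writing \<open>f + f\<close> for a doubled element
  and dividing by 2 inside the ideal.
\<close>

locale Cq_presentation = presentation G R
  for G :: "'g set" and R :: "(('g, Cq) ncpoly \<times> ('g, Cq) ncpoly) set"
begin

abbreviation "I \<equiv> relation_ideal G R"

lemma double_ideal_iff: "f + f \<in> I \<longleftrightarrow> f \<in> I"
  using ideal_closed(2)[of f f] ideal_closed(5)[OF polys_scalar, of "f + f" "inverse 2"]
  by (auto simp only: half_double)

lemma sum_diff_ideal_iff: "f - g \<in> I \<and> f + g \<in> I \<longleftrightarrow> f \<in> I \<and> g \<in> I"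
proof
  assume *: "f - g \<in> I \<and> f + g \<in> I"
  have "f + f = (f - g) + (f + g)" "g + g = (f + g) - (f - g)"
    by simp_all
  then show "f \<in> I \<and> g \<in> I"
    using * by (metis ideal_closed(2,4) double_ideal_iff)
qed (simp add: ideal_closed)

lemma inverse_commutes:
  assumes inv: "u * v \<approx> 1" "v * u \<approx> 1" and comm: "u * w \<approx> w * u"
    and polys: "u \<in> polys G" "v \<in> polys G" "w \<in> polys G"
  shows "v * w \<approx> w * v"
proof -
  \<comment> \<open>This is \<open>v w = v (w u) v = v (u w) v = w v\<close> with the error terms collected.\<close>
  have "v * w - w * v = (v * u - 1) * (w * v) - v * (u * w - w * u) * v - (v * w) * (u * v - 1)"
    by (simp add: algebra_simps)
  then show ?thesis
    using assms by (simp add: cong_def ideal_closed)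
qed

lemma quadratic_iff:
  assumes "T \<in> polys G" "t = T + T - scalar eps"
  shows "(T - scalar q) * (T + scalar (inverse q)) \<approx> 0
    \<longleftrightarrow> t\<^sup>2 \<approx> scalar (q\<^sup>2 + (inverse q)\<^sup>2 + 2)"
proof -
  let ?f = "T * T - scalar eps * T - 1"
  have "t\<^sup>2 - scalar (q\<^sup>2 + (inverse q)\<^sup>2 + 2) = (?f + ?f) + (?f + ?f)"
    unfolding assms(2) scalar_eps_square unfolding power2_eq_square
    by (simp add: algebra_simps scalar_central[of T])
  then show ?thesis
    using assms by (simp add: cong_def quadratic_factors double_ideal_iff)
qed

lemma T_commute_iff:
  assumes "T \<in> polys G" "S \<in> polys G" "t = T + T - scalar eps" "s = S + S - scalar eps"
  shows "T * S \<approx> S * T \<longleftrightarrow> t * s \<approx> s * t"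
proof -
  let ?f = "T * S - S * T"
  have "t * s - s * t = (?f + ?f) + (?f + ?f)"
    by (simp add: assms(3,4) algebra_simps scalar_central[of T] scalar_central[of S])
  then show ?thesis
    using assms by (simp add: cong_def double_ideal_iff)
qed

lemma braid_iff:
  assumes polys: "T \<in> polys G" "S \<in> polys G"
    and t: "t = T + T - scalar eps" and s: "s = S + S - scalar eps"
    and quad: "(T - scalar q) * (T + scalar (inverse q)) \<approx> 0"
      "(S - scalar q) * (S + scalar (inverse q)) \<approx> 0"
  shows "T * S * T \<approx> S * T * S
    \<longleftrightarrow> t * s * t - s * t * s \<approx> scalar (eps\<^sup>2) * (s - t)"
proof -
  let ?f = "T * S * T - S * T * S"
  let ?d = "scalar eps * ((T * T - scalar eps * T - 1) - (S * S - scalar eps * S - 1))"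
  \<comment> \<open>The term \<open>?d\<close> is a quarter of the difference \<open>\<epsilon> (t\<^sup>2 - s\<^sup>2)\<close>.\<close>
  let ?h = "?f + ?f - ?d"
  have d: "?d \<in> I"
    using quad by (simp only: quadratic_factors cong_def diff_0_right ideal_closed polys_scalar)
  have "(t * s * t - s * t * s) - scalar (eps\<^sup>2) * (s - t) = (?h + ?h) + (?h + ?h)"
    by (simp add: t s power2_eq_square scalar_simps(4) algebra_simps
        scalar_central[of T] scalar_central[of S])
  moreover have "?h \<in> I \<longleftrightarrow> ?f + ?f \<in> I"
    using d ideal_closed(2)[of ?h ?d] ideal_closed(4)[of "?f + ?f" ?d] by auto
  ultimately show ?thesis
    using polys by (simp add: cong_def double_ideal_iff t s)
qed

lemma inverse_iff:
  assumes "P \<in> polys G" "Q \<in> polys G" "X = P + Q" "Y = P - Q"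
  shows "X * Y \<approx> 1 \<and> Y * X \<approx> 1 \<longleftrightarrow> P\<^sup>2 - Q\<^sup>2 \<approx> 1 \<and> P * Q \<approx> Q * P"
proof -
  let ?f = "P\<^sup>2 - Q\<^sup>2 - 1" and ?g = "P * Q - Q * P"
  have XY: "X * Y - 1 = ?f - ?g" "Y * X - 1 = ?f + ?g"
    by (simp_all add: assms(3,4) power2_eq_square algebra_simps)
  have "?f - ?g \<in> I \<and> ?f + ?g \<in> I \<longleftrightarrow> ?f \<in> I \<and> ?g \<in> I"
    by (rule sum_diff_ideal_iff)
  moreover have "X \<in> polys G" "Y \<in> polys G"
    using assms by simp_all
  ultimately show ?thesis
    using assms(1,2) by (simp add: cong_def XY)
qed

text \<open>
  From left to right, commutation spreads from \<open>X, X'\<close> to their inverses; each of the four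
  commutators on the right is a quarter of a signed sum of the four commutators of
  \<open>X, Y\<close> with \<open>X', Y'\<close>.
\<close>

lemma X_commute_iff:
  assumes polys: "P \<in> polys G" "Q \<in> polys G" "P' \<in> polys G" "Q' \<in> polys G"
    and X: "X = P + Q" "Y = P - Q" and X': "X' = P' + Q'" "Y' = P' - Q'"
    and inv: "X * Y \<approx> 1" "Y * X \<approx> 1" "X' * Y' \<approx> 1" "Y' * X' \<approx> 1"
  shows "X * X' \<approx> X' * X
    \<longleftrightarrow> P * P' \<approx> P' * P \<and> Q * Q' \<approx> Q' * Q \<and> P * Q' \<approx> Q' * P \<and> P' * Q \<approx> Q * P'"
    (is "?L \<longleftrightarrow> ?R")
proof
  assume ?R
  moreover have "X * X' - X' * X
      = (P * P' - P' * P) + (Q * Q' - Q' * Q) + (P * Q' - Q' * P) - (P' * Q - Q * P')"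
    by (simp add: X X' algebra_simps)
  ultimately show ?L
    using polys by (simp add: cong_def X X' ideal_closed)
next
  assume ?L
  have XY_polys: "X \<in> polys G" "Y \<in> polys G" "X' \<in> polys G" "Y' \<in> polys G"
    using polys by (simp_all add: X X')
  have YX': "Y * X' \<approx> X' * Y"
    using inverse_commutes[OF inv(1,2) \<open>?L\<close>] XY_polys by simp
  have Y'X: "Y' * X \<approx> X * Y'"
    using inverse_commutes[OF inv(3,4) cong_sym[OF \<open>?L\<close>]] XY_polys by simp
  have Y'Y: "Y' * Y \<approx> Y * Y'"
    using inverse_commutes[OF inv(3,4) cong_sym[OF YX']] XY_polys by simp
  let ?a = "X * X' - X' * X" and ?b = "Y * X' - X' * Y" and ?c = "X * Y' - Y' * X"
    and ?d = "Y * Y' - Y' * Y"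
  have I: "?a \<in> I" "?b \<in> I" "?c \<in> I" "?d \<in> I"
    using \<open>?L\<close> YX' cong_sym[OF Y'X] cong_sym[OF Y'Y] by (simp_all add: cong_def)
  have quadruple: "f \<in> I" if "g \<in> I" "(f + f) + (f + f) = g" for f g
    using that by (metis double_ideal_iff)
  have "P * P' - P' * P \<in> I"
    by (rule quadruple[of "?a + ?b + ?c + ?d"])
      (simp_all only: I ideal_closed, simp add: X X' algebra_simps)
  moreover have "Q * Q' - Q' * Q \<in> I"
    by (rule quadruple[of "?a - ?b - ?c + ?d"])
      (simp_all only: I ideal_closed, simp add: X X' algebra_simps)
  moreover have "P * Q' - Q' * P \<in> I"
    by (rule quadruple[of "?a + ?b - ?c - ?d"])
      (simp_all only: I ideal_closed, simp add: X X' algebra_simps)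
  moreover have "P' * Q - Q * P' \<in> I"
    by (rule quadruple[of "?b - ?a - ?c + ?d"])
      (simp_all only: I ideal_closed, simp add: X X' algebra_simps)
  ultimately show ?R
    using polys by (simp add: cong_def)
qed

text \<open>
  The commutators of \<open>t\<close> with \<open>P\<close> and \<open>Q\<close> are half the sum and half the difference of those of
  \<open>t\<close> with \<open>X\<close> and \<open>Y\<close>, and the latter are twice those of \<open>T\<close>.
\<close>

lemma T_X_commute_iff:
  assumes polys: "T \<in> polys G" "P \<in> polys G" "Q \<in> polys G"
    and t: "t = T + T - scalar eps" and X: "X = P + Q" "Y = P - Q"
    and inv: "X * Y \<approx> 1" "Y * X \<approx> 1"
  shows "T * X \<approx> X * T \<longleftrightarrow> t * P \<approx> P * t \<and> t * Q \<approx> Q * t"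
    (is "?L \<longleftrightarrow> ?R")
proof -
  let ?p = "t * P - P * t" and ?r = "t * Q - Q * t"
  let ?k = "T * X - X * T" and ?m = "T * Y - Y * T"
  have sum: "?p - ?r = ?m + ?m" "?p + ?r = ?k + ?k"
    by (simp_all add: t X algebra_simps scalar_central[of P] scalar_central[of Q])
  have "?L \<Longrightarrow> T * Y \<approx> Y * T"
    using inverse_commutes[OF inv, of T] polys by (simp add: X cong_sym)
  then have "?L \<longleftrightarrow> ?m \<in> I \<and> ?k \<in> I"
    using polys by (auto simp: cong_def X)
  also have "\<dots> \<longleftrightarrow> ?p - ?r \<in> I \<and> ?p + ?r \<in> I"
    by (simp only: sum double_ideal_iff)
  also have "\<dots> \<longleftrightarrow> ?R"
    using polys by (simp add: sum_diff_ideal_iff cong_def t)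
  finally show ?thesis .
qed

text \<open>
  Both sides say that \<open>T X = X' T\<^sup>-\<^sup>1\<close> and \<open>T\<^sup>-\<^sup>1 Y = Y' T\<close>, where
  \<open>T\<^sup>-\<^sup>1 = T - \<epsilon>\<close>. Of these two equations the second follows from the first by
  inverting the \<open>X\<close>'s. Their defects are \<open>?k\<close> and \<open>?m\<close> in the proof, and the defects of the
  relations for \<open>P\<close> and \<open>Q\<close> have sum \<open>2 ?k\<close> and difference \<open>2 ?m\<close>.
\<close>

lemma T_X_T_iff:
  assumes polys: "T \<in> polys G" "P \<in> polys G" "Q \<in> polys G" "P' \<in> polys G" "Q' \<in> polys G"
    and t: "t = T + T - scalar eps"
    and X: "X = P + Q" "Y = P - Q" and X': "X' = P' + Q'" "Y' = P' - Q'"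
    and quad: "(T - scalar q) * (T + scalar (inverse q)) \<approx> 0"
    and inv: "X * Y \<approx> 1" "Y' * X' \<approx> 1"
  shows "T * X * T \<approx> X'
    \<longleftrightarrow> t * P \<approx> P' * t - scalar eps * (Q' + Q) \<and> t * Q \<approx> Q' * t - scalar eps * (P + P')"
    (is "?L \<longleftrightarrow> ?R")
proof -
  let ?e = "scalar eps"
  let ?A = "T * T - ?e * T - 1"
  let ?p = "t * P - (P' * t - ?e * (Q' + Q))" and ?r = "t * Q - (Q' * t - ?e * (P + P'))"
  let ?k = "T * X - X' * (T - ?e)" and ?m = "(T - ?e) * Y - Y' * T"
  have A: "?A \<in> I"
    using quad by (simp add: cong_def quadratic_factors)
  have XY_polys: "X \<in> polys G" "Y \<in> polys G" "X' \<in> polys G" "Y' \<in> polys G"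
    using polys by (simp_all add: X X')
  have inv_I: "X * Y - 1 \<in> I" "Y' * X' - 1 \<in> I"
    using inv by (simp_all add: cong_def)
  have sum: "?p - ?r = ?m + ?m" "?p + ?r = ?k + ?k"
    by (simp_all add: t X X' algebra_simps scalar_central[of P'] scalar_central[of Q'])
  have k: "?k \<in> I" if "T * X * T - X' \<in> I"
  proof -
    \<comment> \<open>Multiply on the right by \<open>T - \<epsilon>\<close>; the last term corrects \<open>T (T - \<epsilon>)\<close> to 1.\<close>
    have "?k = (T * X * T - X') * (T - ?e) - T * X * ?A"
      by (simp add: algebra_simps scalar_central[of T])
    then show ?thesis
      using that A polys XY_polys by (simp only: ideal_closed polys_diff polys_mult polys_scalar)
  qed
  have m: "?m \<in> I" if "?k \<in> I"
  proof -
    \<comment> \<open>Multiply \<open>T X = X' (T - \<epsilon>)\<close> by \<open>Y'\<close> on the left and by \<open>Y\<close> on the right.\<close>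
    have "?m = Y' * T * (X * Y - 1) - Y' * ?k * Y - (Y' * X' - 1) * ((T - ?e) * Y)"
      by (simp add: algebra_simps)
    then show ?thesis
      using that inv_I polys XY_polys
      by (simp only: ideal_closed polys_diff polys_mult polys_scalar)
  qed
  have L: "T * X * T - X' \<in> I" if "?k \<in> I"
  proof -
    have "T * X * T - X' = ?k * T + X' * ?A"
      by (simp add: algebra_simps)
    then show ?thesis
      using that A polys XY_polys by (simp only: ideal_closed)
  qed
  have "?L \<longleftrightarrow> T * X * T - X' \<in> I"
    using polys XY_polys by (simp add: cong_def)
  also have "\<dots> \<longleftrightarrow> ?m \<in> I \<and> ?k \<in> I"
    using k m L by blast
  also have "\<dots> \<longleftrightarrow> ?p - ?r \<in> I \<and> ?p + ?r \<in> I"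
    by (simp only: sum double_ideal_iff)
  also have "\<dots> \<longleftrightarrow> ?R"
    using polys by (simp only: sum_diff_ideal_iff) (simp add: cong_def t)
  finally show ?thesis .
qed

end

section \<open>The two presentations\<close>

lemma hecke_presentation: "presentation (hecke_gens n) (hecke_relations n)"
  by unfold_locales
    (auto simp: hecke_relations_def Let_def hecke_gens_def
      intro!: polys_mult polys_add polys_diff polys_power polys_var polys_scalar polys_one)

lemma pq_presentation: "presentation (pq_gens n) (pq_relations n \<union> pq_far_relations n)"
  by unfold_locales
    (auto simp: pq_relations_def pq_far_relations_def Let_def pq_gens_def
      intro!: polys_mult polys_add polys_diff polys_power polys_var polys_scalar polys_one)

lemma ball_family:
  "(\<forall>x\<in>{f i |i. A i}. B x) \<longleftrightarrow> (\<forall>i. A i \<longrightarrow> B (f i))"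
  "(\<forall>x\<in>{g i j |i j. C i j}. B x) \<longleftrightarrow> (\<forall>i j. C i j \<longrightarrow> B (g i j))"
  by blast+

context Cq_presentation
begin

lemma solves_hecke_iff:
  fixes \<sigma> :: "hecke_gen \<Rightarrow> ('g, Cq) ncpoly"
  defines "T \<equiv> \<lambda>i. \<sigma> (T_gen i)" and "X \<equiv> \<lambda>j. \<sigma> (X_gen j)" and "Y \<equiv> \<lambda>j. \<sigma> (Xinv_gen j)"
  shows "solves G R \<sigma> (hecke_relations n) \<longleftrightarrow>
    (\<forall>j\<in>{1..n}. X j * Y j \<approx> 1) \<and>
    (\<forall>j\<in>{1..n}. Y j * X j \<approx> 1) \<and>
    (\<forall>i\<in>{1..<n}. (T i - scalar q) * (T i + scalar (inverse q)) \<approx> 0) \<and>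
    (\<forall>i\<in>{1..<n}. i + 1 \<in> {1..<n} \<longrightarrow> T i * T (i+1) * T i \<approx> T (i+1) * T i * T (i+1)) \<and>
    (\<forall>i\<in>{1..<n}. \<forall>j\<in>{1..<n}. \<bar>int i - int j\<bar> > 1 \<longrightarrow> T i * T j \<approx> T j * T i) \<and>
    (\<forall>i\<in>{1..n}. \<forall>j\<in>{1..n}. X i * X j \<approx> X j * X i) \<and>
    (\<forall>i\<in>{1..<n}. T i * X i * T i \<approx> X (i+1)) \<and>
    (\<forall>i\<in>{1..<n}. \<forall>j\<in>{1..n}. j \<noteq> i \<and> j \<noteq> i + 1 \<longrightarrow> T i * X j \<approx> X j * T i)"
  unfolding solves_def hecke_relations_def Let_def ball_Un ball_family T_def X_def Y_def
  by (simp only: prod.case subst_mult subst_add subst_diff subst_var subst_scalar subst_one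
      subst_zero Ball_def imp_conjL conj_assoc all_simps)

lemma solves_pq_iff:
  fixes \<tau> :: "pq_gen \<Rightarrow> ('g, Cq) ncpoly"
  defines "t \<equiv> \<lambda>i. \<tau> (calT_gen i)" and "P \<equiv> \<lambda>j. \<tau> (P_gen j)" and "Q \<equiv> \<lambda>j. \<tau> (Q_gen j)"
  shows "solves G R \<tau> (pq_relations n \<union> pq_far_relations n) \<longleftrightarrow>
    (\<forall>i\<in>{1..<n}. (t i)\<^sup>2 \<approx> scalar (q\<^sup>2 + (inverse q)\<^sup>2 + 2)) \<and>
    (\<forall>i\<in>{1..<n}. \<forall>j\<in>{1..<n}. \<bar>int i - int j\<bar> > 1 \<longrightarrow> t i * t j \<approx> t j * t i) \<and>
    (\<forall>i\<in>{1..<n}. i + 1 \<in> {1..<n} \<longrightarrow>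
      t i * t (i+1) * t i - t (i+1) * t i * t (i+1) \<approx> scalar (eps\<^sup>2) * (t (i+1) - t i)) \<and>
    (\<forall>i\<in>{1..n}. \<forall>j\<in>{1..n}. i \<noteq> j \<longrightarrow> P i * P j \<approx> P j * P i) \<and>
    (\<forall>i\<in>{1..n}. \<forall>j\<in>{1..n}. i \<noteq> j \<longrightarrow> Q i * Q j \<approx> Q j * Q i) \<and>
    (\<forall>j\<in>{1..n}. (P j)\<^sup>2 - (Q j)\<^sup>2 \<approx> 1) \<and>
    (\<forall>i\<in>{1..n}. \<forall>j\<in>{1..n}. P i * Q j \<approx> Q j * P i) \<and>
    (\<forall>i\<in>{1..<n}. t i * P i \<approx> P (i+1) * t i - scalar eps * (Q (i+1) + Q i)) \<and>
    (\<forall>i\<in>{1..<n}. t i * Q i \<approx> Q (i+1) * t i - scalar eps * (P i + P (i+1))) \<and>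
    (\<forall>i\<in>{1..<n}. \<forall>j\<in>{1..n}. j \<noteq> i \<and> j \<noteq> i + 1 \<longrightarrow> t i * P j \<approx> P j * t i) \<and>
    (\<forall>i\<in>{1..<n}. \<forall>j\<in>{1..n}. j \<noteq> i \<and> j \<noteq> i + 1 \<longrightarrow> t i * Q j \<approx> Q j * t i)"
  unfolding solves_def pq_relations_def pq_far_relations_def Let_def ball_Un ball_family
    t_def P_def Q_def
  by (simp only: prod.case subst_mult subst_add subst_diff subst_var subst_scalar subst_one
      subst_power Ball_def imp_conjL conj_assoc all_simps)

text \<open>
  Invertibility and the quadratic relations are compared first, because the other comparisons
  hold only modulo them.
\<close>

theorem solves_hecke_iff_solves_pq:
  assumes polys: "\<And>i. i \<in> {1..<n} \<Longrightarrow> \<sigma> (T_gen i) \<in> polys G"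
      "\<And>j. j \<in> {1..n} \<Longrightarrow> \<tau> (P_gen j) \<in> polys G"
      "\<And>j. j \<in> {1..n} \<Longrightarrow> \<tau> (Q_gen j) \<in> polys G"
    and t: "\<And>i. i \<in> {1..<n} \<Longrightarrow> \<tau> (calT_gen i) = \<sigma> (T_gen i) + \<sigma> (T_gen i) - scalar eps"
    and X: "\<And>j. j \<in> {1..n} \<Longrightarrow> \<sigma> (X_gen j) = \<tau> (P_gen j) + \<tau> (Q_gen j)"
      "\<And>j. j \<in> {1..n} \<Longrightarrow> \<sigma> (Xinv_gen j) = \<tau> (P_gen j) - \<tau> (Q_gen j)"
  shows "solves G R \<sigma> (hecke_relations n)
    \<longleftrightarrow> solves G R \<tau> (pq_relations n \<union> pq_far_relations n)"
proof -
  define T X Y where "T i = \<sigma> (T_gen i)" and "X i = \<sigma> (X_gen i)" and "Y i = \<sigma> (Xinv_gen i)" for i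
  define t P Q where "t i = \<tau> (calT_gen i)" and "P i = \<tau> (P_gen i)" and "Q i = \<tau> (Q_gen i)" for i
  note defs = T_def X_def Y_def t_def P_def Q_def
  have Suc: "i \<in> {1..n}" "i + 1 \<in> {1..n}" if "i \<in> {1..<n}" for i
    using that by auto
  have inverse: "X j * Y j \<approx> 1 \<and> Y j * X j \<approx> 1 \<longleftrightarrow> (P j)\<^sup>2 - (Q j)\<^sup>2 \<approx> 1 \<and> P j * Q j \<approx> Q j * P j"
    if "j \<in> {1..n}" for j
    unfolding defs using that by (intro inverse_iff polys X)
  have quadratic: "(T i - scalar q) * (T i + scalar (inverse q)) \<approx> 0
      \<longleftrightarrow> (t i)\<^sup>2 \<approx> scalar (q\<^sup>2 + (inverse q)\<^sup>2 + 2)"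
    if "i \<in> {1..<n}" for i
    unfolding defs using that by (intro quadratic_iff polys t)
  have TT: "T i * T j \<approx> T j * T i \<longleftrightarrow> t i * t j \<approx> t j * t i"
    if "i \<in> {1..<n}" "j \<in> {1..<n}" for i j
    unfolding defs using that by (intro T_commute_iff polys t)
  have braid: "T i * T j * T i \<approx> T j * T i * T j
      \<longleftrightarrow> t i * t j * t i - t j * t i * t j \<approx> scalar (eps\<^sup>2) * (t j - t i)"
    if "i \<in> {1..<n}" "j \<in> {1..<n}"
      "(T i - scalar q) * (T i + scalar (inverse q)) \<approx> 0"
      "(T j - scalar q) * (T j + scalar (inverse q)) \<approx> 0" for i j
    using that(3,4) unfolding defs by (intro braid_iff polys t that(1,2))
  have XX: "X i * X j \<approx> X j * X i \<longleftrightarrow>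
      P i * P j \<approx> P j * P i \<and> Q i * Q j \<approx> Q j * Q i \<and> P i * Q j \<approx> Q j * P i \<and> P j * Q i \<approx> Q i * P j"
    if "i \<in> {1..n}" "j \<in> {1..n}" "X i * Y i \<approx> 1 \<and> Y i * X i \<approx> 1" "X j * Y j \<approx> 1 \<and> Y j * X j \<approx> 1"
    for i j
    using that(3,4) unfolding defs
    by (intro X_commute_iff[of _ _ _ _ _ "\<sigma> (Xinv_gen i)" _ "\<sigma> (Xinv_gen j)"] polys X that(1,2)) auto
  have TX: "T i * X j \<approx> X j * T i \<longleftrightarrow> t i * P j \<approx> P j * t i \<and> t i * Q j \<approx> Q j * t i"
    if "i \<in> {1..<n}" "j \<in> {1..n}" "X j * Y j \<approx> 1 \<and> Y j * X j \<approx> 1" for i j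
    using that(3) unfolding defs
    by (intro T_X_commute_iff[of _ _ _ _ _ "\<sigma> (Xinv_gen j)"] polys t X that(1,2)) auto
  have TXT: "T i * X i * T i \<approx> X (i+1) \<longleftrightarrow>
      t i * P i \<approx> P (i+1) * t i - scalar eps * (Q (i+1) + Q i) \<and>
      t i * Q i \<approx> Q (i+1) * t i - scalar eps * (P i + P (i+1))"
    if "i \<in> {1..<n}" "(T i - scalar q) * (T i + scalar (inverse q)) \<approx> 0"
      "X i * Y i \<approx> 1 \<and> Y i * X i \<approx> 1" "X (i+1) * Y (i+1) \<approx> 1 \<and> Y (i+1) * X (i+1) \<approx> 1" for i
    using that(2-4) unfolding defs
    by (intro T_X_T_iff[of _ _ _ _ _ _ _ "\<sigma> (Xinv_gen i)" _ "\<sigma> (Xinv_gen (i+1))"]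
        polys t X Suc that(1)) auto
  \<comment> \<open>The relations between the \<open>P\<close>'s, and between the \<open>Q\<close>'s, are imposed for \<open>i \<noteq> j\<close> only,
    but those between the \<open>X\<close>'s include the trivial case \<open>i = j\<close>.\<close>
  have off_diagonal: "(i \<noteq> j \<longrightarrow> P i * P j \<approx> P j * P i) \<longleftrightarrow> P i * P j \<approx> P j * P i"
      "(i \<noteq> j \<longrightarrow> Q i * Q j \<approx> Q j * Q i) \<longleftrightarrow> Q i * Q j \<approx> Q j * Q i"
    if "i \<in> {1..n}" for i j
    using that by (auto simp: defs intro!: cong_refl polys polys_mult)
  let ?XY = "\<forall>j\<in>{1..n}. X j * Y j \<approx> 1" and ?YX = "\<forall>j\<in>{1..n}. Y j * X j \<approx> 1"
  let ?quad = "\<forall>i\<in>{1..<n}. (T i - scalar q) * (T i + scalar (inverse q)) \<approx> 0"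
  let ?PQ = "\<forall>i\<in>{1..n}. \<forall>j\<in>{1..n}. P i * Q j \<approx> Q j * P i"
  have basic: "?XY \<and> ?YX \<and> ?quad \<longleftrightarrow>
      (\<forall>j\<in>{1..n}. (P j)\<^sup>2 - (Q j)\<^sup>2 \<approx> 1) \<and> (\<forall>j\<in>{1..n}. P j * Q j \<approx> Q j * P j) \<and>
      (\<forall>i\<in>{1..<n}. (t i)\<^sup>2 \<approx> scalar (q\<^sup>2 + (inverse q)\<^sup>2 + 2))"
    using inverse quadratic by (simp only: ball_conj_distrib[symmetric] conj_assoc[symmetric] cong: ball_cong)
  have TT_all: "(\<forall>i\<in>{1..<n}. \<forall>j\<in>{1..<n}. \<bar>int i - int j\<bar> > 1 \<longrightarrow> T i * T j \<approx> T j * T i) \<longleftrightarrow>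
      (\<forall>i\<in>{1..<n}. \<forall>j\<in>{1..<n}. \<bar>int i - int j\<bar> > 1 \<longrightarrow> t i * t j \<approx> t j * t i)"
    by (simp only: TT cong: ball_cong)
  have braid_all: "(\<forall>i\<in>{1..<n}. i + 1 \<in> {1..<n} \<longrightarrow>
        T i * T (i+1) * T i \<approx> T (i+1) * T i * T (i+1)) \<longleftrightarrow>
      (\<forall>i\<in>{1..<n}. i + 1 \<in> {1..<n} \<longrightarrow>
        t i * t (i+1) * t i - t (i+1) * t i * t (i+1) \<approx> scalar (eps\<^sup>2) * (t (i+1) - t i))"
    if ?quad
    using that by (simp only: braid cong: ball_cong imp_cong)
  have XX_all: "(\<forall>i\<in>{1..n}. \<forall>j\<in>{1..n}. X i * X j \<approx> X j * X i) \<longleftrightarrow>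
      (\<forall>i\<in>{1..n}. \<forall>j\<in>{1..n}. i \<noteq> j \<longrightarrow> P i * P j \<approx> P j * P i) \<and>
      (\<forall>i\<in>{1..n}. \<forall>j\<in>{1..n}. i \<noteq> j \<longrightarrow> Q i * Q j \<approx> Q j * Q i) \<and> ?PQ"
    if ?XY ?YX
  proof -
    have "(\<forall>i\<in>{1..n}. \<forall>j\<in>{1..n}. X i * X j \<approx> X j * X i) \<longleftrightarrow>
      (\<forall>i\<in>{1..n}. \<forall>j\<in>{1..n}. P i * P j \<approx> P j * P i \<and> Q i * Q j \<approx> Q j * Q i \<and>
        P i * Q j \<approx> Q j * P i \<and> P j * Q i \<approx> Q i * P j)"
      using that by (simp only: XX simp_thms cong: ball_cong)
    then show ?thesis
      by (simp only: off_diagonal cong: ball_cong) blast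
  qed
  have TXT_all: "(\<forall>i\<in>{1..<n}. T i * X i * T i \<approx> X (i+1)) \<longleftrightarrow>
      (\<forall>i\<in>{1..<n}. t i * P i \<approx> P (i+1) * t i - scalar eps * (Q (i+1) + Q i)) \<and>
      (\<forall>i\<in>{1..<n}. t i * Q i \<approx> Q (i+1) * t i - scalar eps * (P i + P (i+1)))"
    if ?XY ?YX ?quad
    using that by (simp only: TXT Suc simp_thms ball_conj_distrib cong: ball_cong)
  have TX_all: "(\<forall>i\<in>{1..<n}. \<forall>j\<in>{1..n}. j \<noteq> i \<and> j \<noteq> i + 1 \<longrightarrow> T i * X j \<approx> X j * T i) \<longleftrightarrow>
      (\<forall>i\<in>{1..<n}. \<forall>j\<in>{1..n}. j \<noteq> i \<and> j \<noteq> i + 1 \<longrightarrow> t i * P j \<approx> P j * t i) \<and>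
      (\<forall>i\<in>{1..<n}. \<forall>j\<in>{1..n}. j \<noteq> i \<and> j \<noteq> i + 1 \<longrightarrow> t i * Q j \<approx> Q j * t i)"
    if ?XY ?YX
    using that by (simp only: TX simp_thms ball_conj_distrib imp_conjR cong: ball_cong)
  \<comment> \<open>The case \<open>i = j\<close> of \<open>P\<^sub>i Q\<^sub>j = Q\<^sub>j P\<^sub>i\<close> is needed, with \<open>P\<^sub>j\<^sup>2 - Q\<^sub>j\<^sup>2 = 1\<close>,
    for \<open>P\<^sub>j + Q\<^sub>j\<close> and \<open>P\<^sub>j - Q\<^sub>j\<close> to be mutually inverse.\<close>
  have diagonal: "?PQ \<Longrightarrow> \<forall>j\<in>{1..n}. P j * Q j \<approx> Q j * P j"
    by blast
  show ?thesis
    unfolding solves_hecke_iff solves_pq_iff defs[symmetric]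
    using basic TT_all braid_all XX_all TXT_all TX_all diagonal by argo
qed

end

section \<open>The change of generators\<close>

primrec hecke_in_pq :: "hecke_gen \<Rightarrow> (pq_gen, Cq) ncpoly" where
  "hecke_in_pq (T_gen i) = scalar (inverse 2) * (var (calT_gen i) + scalar eps)"
| "hecke_in_pq (X_gen j) = var (P_gen j) + var (Q_gen j)"
| "hecke_in_pq (Xinv_gen j) = var (P_gen j) - var (Q_gen j)"

primrec pq_in_hecke :: "pq_gen \<Rightarrow> (hecke_gen, Cq) ncpoly" where
  "pq_in_hecke (calT_gen i) = scalar 2 * var (T_gen i) - scalar eps"
| "pq_in_hecke (P_gen j) = scalar (inverse 2) * (var (X_gen j) + var (Xinv_gen j))"
| "pq_in_hecke (Q_gen j) = scalar (inverse 2) * (var (X_gen j) - var (Xinv_gen j))"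

text \<open>
  Both changes of generators involve the factor \<open>1/2\<close>; these identities cancel it when one
  is substituted into the other.
\<close>

lemma half_identities:
  fixes f g :: "('g, Cq) ncpoly"
  shows "scalar (inverse 2) * f + scalar (inverse 2) * f = f"
    and "scalar 2 * f = f + f"
    and "scalar (inverse 2) * (f + g) + scalar (inverse 2) * (f - g) = f"
    and "scalar (inverse 2) * (f + g) - scalar (inverse 2) * (f - g) = g"
proof -
  show half: "scalar (inverse 2) * f + scalar (inverse 2) * f = f" for f :: "('g, Cq) ncpoly"
    using half_double[of f] by (simp only: distrib_left)
  show "scalar 2 * f = f + f"
    unfolding one_add_one[symmetric] scalar_simps by (simp only: distrib_right mult_1)
  show "scalar (inverse 2) * (f + g) + scalar (inverse 2) * (f - g) = f"
    using half[of f] by (simp add: algebra_simps)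
  show "scalar (inverse 2) * (f + g) - scalar (inverse 2) * (f - g) = g"
    using half[of g] by (simp add: algebra_simps)
qed

text \<open>
  The quadratic relation gives \<open>T\<^sub>i (T\<^sub>i - \<epsilon>) = 1\<close>, so that \<open>\<T>\<^sub>i = T\<^sub>i + T\<^sub>i\<^sup>-\<^sup>1\<close> is the
  residue class of the letter combination \<open>2 T\<^sub>i - \<epsilon>\<close> used in the change of generators; likewise for
  \<open>P\<^sub>j\<close> and \<open>Q\<^sub>j\<close>.
\<close>

theorem proposition4p4:
  fixes n :: nat
  shows "(\<forall>i\<in>{1..<n}. T_elt n i \<in> Units (affine_hecke n) \<and>
            calT_elt n i =
              2 \<odot>\<^bsub>affine_hecke n\<^esub> T_elt n i
                \<ominus>\<^bsub>affine_hecke n\<^esub> eps \<odot>\<^bsub>affine_hecke n\<^esub> \<one>\<^bsub>affine_hecke n\<^esub>)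
       \<and> (\<forall>j\<in>{1..n}. X_elt n j \<in> Units (affine_hecke n))
       \<and> is_presented_by (affine_hecke n) (pq_elt n) (pq_gens n)
           (pq_relations n \<union> pq_far_relations n)"
proof -
  interpret H: Cq_presentation "hecke_gens n" "hecke_relations n"
    unfolding Cq_presentation_def by (rule hecke_presentation)
  interpret PQ: Cq_presentation "pq_gens n" "pq_relations n \<union> pq_far_relations n"
    unfolding Cq_presentation_def by (rule pq_presentation)
  have hecke_vars: "var (T_gen i) \<in> polys (hecke_gens n)" if "i \<in> {1..<n}" for i
    using that by (intro polys_var) (simp add: hecke_gens_def)
  have hecke_vars': "var (X_gen j) \<in> polys (hecke_gens n)" "var (Xinv_gen j) \<in> polys (hecke_gens n)"
    if "j \<in> {1..n}" for j
    using that by (auto intro!: polys_var simp: hecke_gens_def)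
  have pq_vars: "var (calT_gen i) \<in> polys (pq_gens n)" if "i \<in> {1..<n}" for i
    using that by (intro polys_var) (simp add: pq_gens_def)
  have pq_vars': "var (P_gen j) \<in> polys (pq_gens n)" "var (Q_gen j) \<in> polys (pq_gens n)"
    if "j \<in> {1..n}" for j
    using that by (auto intro!: polys_var simp: pq_gens_def)
  have pq_in_hecke_polys: "pq_in_hecke ` pq_gens n \<subseteq> polys (hecke_gens n)"
    by (auto simp: pq_gens_def hecke_vars hecke_vars' intro!: polys_mult polys_add polys_diff)
  have hecke_in_pq_polys: "hecke_in_pq ` hecke_gens n \<subseteq> polys (pq_gens n)"
    by (auto simp: hecke_gens_def pq_vars pq_vars' intro!: polys_mult polys_add polys_diff)
  have hecke_rels: "solves (hecke_gens n) (hecke_relations n) var (hecke_relations n)"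
    by (rule H.var_solves)
  have "solves (hecke_gens n) (hecke_relations n) pq_in_hecke (pq_relations n \<union> pq_far_relations n)"
    using hecke_rels
    by (subst (asm) H.solves_hecke_iff_solves_pq[where \<tau> = pq_in_hecke])
      (simp_all add: half_identities hecke_vars hecke_vars' del: inverse_eq_divide_numeral)
  moreover have "solves (pq_gens n) (pq_relations n \<union> pq_far_relations n) hecke_in_pq (hecke_relations n)"
    by (subst PQ.solves_hecke_iff_solves_pq[where \<tau> = var])
      (simp_all add: half_identities pq_vars pq_vars' PQ.var_solves del: inverse_eq_divide_numeral)
  ultimately have presented: "is_presented_by (affine_hecke n)
      (\<lambda>g. H.residue (pq_in_hecke g)) (pq_gens n) (pq_relations n \<union> pq_far_relations n)"
    unfolding affine_hecke_def
    by (intro presented_by_inverse_substitutions[where b = hecke_in_pq] pq_presentation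
        hecke_presentation pq_in_hecke_polys hecke_in_pq_polys)
      (auto simp: hecke_gens_def pq_gens_def half_identities half_double
        simp del: inverse_eq_divide_numeral)
  have T: "T_elt n i \<in> Units H.alg" "inv\<^bsub>H.alg\<^esub> T_elt n i = H.residue (var (T_gen i) - scalar eps)"
    if "i \<in> {1..<n}" for i
  proof -
    have "(var (T_gen i) - scalar q) * (var (T_gen i) + scalar (inverse q)) \<in> H.I"
      using hecke_rels that unfolding H.solves_hecke_iff by (simp add: H.cong_def)
    then have "var (T_gen i) * (var (T_gen i) - scalar eps) - 1 \<in> H.I"
        "(var (T_gen i) - scalar eps) * var (T_gen i) - 1 \<in> H.I"
      unfolding quadratic_factors
      by (simp_all add: right_diff_distrib left_diff_distrib scalar_commute[of "var (T_gen i)"])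
    then have inverse: "H.cong (var (T_gen i) * (var (T_gen i) - scalar eps)) 1"
        "H.cong ((var (T_gen i) - scalar eps) * var (T_gen i)) 1"
      using that by (simp_all add: H.cong_def hecke_vars)
    from H.residue_inverse[OF inverse] that
    show "T_elt n i \<in> Units H.alg" "inv\<^bsub>H.alg\<^esub> T_elt n i = H.residue (var (T_gen i) - scalar eps)"
      by (simp_all add: T_elt_def hecke_vars)
  qed
  have X: "X_elt n j \<in> Units H.alg" "inv\<^bsub>H.alg\<^esub> X_elt n j = H.residue (var (Xinv_gen j))"
    if "j \<in> {1..n}" for j
  proof -
    have inverse: "H.cong (var (X_gen j) * var (Xinv_gen j)) 1" "H.cong (var (Xinv_gen j) * var (X_gen j)) 1"
      using hecke_rels that unfolding H.solves_hecke_iff by blast+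
    from H.residue_inverse[OF inverse] that
    show "X_elt n j \<in> Units H.alg" "inv\<^bsub>H.alg\<^esub> X_elt n j = H.residue (var (Xinv_gen j))"
      by (simp_all add: X_elt_def hecke_vars')
  qed
  have calT: "calT_elt n i = H.residue (scalar 2 * var (T_gen i) - scalar eps)" if "i \<in> {1..<n}" for i
    unfolding calT_elt_def affine_hecke_def T(2)[OF that] unfolding T_elt_def
    using that by (simp add: H.residue_add hecke_vars half_identities add_diff_eq)
  have PQ: "P_elt n j = H.residue (pq_in_hecke (P_gen j))" "Q_elt n j = H.residue (pq_in_hecke (Q_gen j))"
    if "j \<in> {1..n}" for j
    unfolding P_elt_def Q_elt_def affine_hecke_def X(2)[OF that] unfolding X_elt_def
    using that by (simp_all add: H.residue_add H.residue_diff H.residue_smult hecke_vars')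
  have "pq_elt n g = H.residue (pq_in_hecke g)" if "g \<in> pq_gens n" for g
    using that by (auto simp: pq_gens_def calT PQ)
  then have "is_presented_by (affine_hecke n) (pq_elt n) (pq_gens n)
      (pq_relations n \<union> pq_far_relations n)"
    using presented by (simp add: is_presented_by_def)
  moreover have "calT_elt n i = 2 \<odot>\<^bsub>H.alg\<^esub> T_elt n i \<ominus>\<^bsub>H.alg\<^esub> eps \<odot>\<^bsub>H.alg\<^esub> \<one>\<^bsub>H.alg\<^esub>"
    if "i \<in> {1..<n}" for i
    unfolding calT[OF that] T_elt_def H.residue_one
    using that by (simp add: H.residue_diff H.residue_smult hecke_vars)
  ultimately show ?thesis
    using T(1) X(1) unfolding affine_hecke_def by blast
qed

end
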